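(* Consider the diffusively-coupled system described in the context with homogeneous agents, i.e. $P_i=P_0$ for all $i\in\{1,\dots,\nu\}$, where $P_0$ has a $p\times m$ transfer function in the quotient field of $H_\infty$ admitting right and left coprime factorizations over $H_\infty$. If $P_0(s)$ has at least one pole in $\bar{\mathbb C}_0$, then no choice of LTI edge controllers $K_{\mathrm e,j}$ internally stabilizes the system.
   Context: **Notation.** $\mathbb C_0=\{s\in\mathbb C:\operatorname{Re}s>0\}$, $\bar{\mathbb C}_0=\{s\in\mathbb C:\operatorname{Re}s\ge0\}$. $A^\top$ denotes the complex-conjugate transpose; $\otimes$ is the Kronecker product. $H_\infty^{p\times m}$ is the space of bounded holomorphic functions $\mathbb C_0\to\mathbb C^{p\times m}$; $H_\infty$ is written when dimensions are clear. LTI systems are identified with their transfer functions; a system is (causal and) stable iff its transfer function is in $H_\infty$. "LTI" plants and controllers are those whose transfer-function entries belong to the quotient field of $H_\infty$. A pole of $P_0(s)$ at an imaginary-axis point $\lambda$ means that $P_0$ extends meromorphically to a neighbourhood of $\lambda$ and has a pole at $\lambda$. **Coprime factorizations.** $M\in H_\infty^{m\times m}$, $N\in H_\infty^{p\times m}$ are right coprime if there are $X,Y\in H_\infty$ with $XM+YN=I_m$. $\tilde M\in H_\infty^{p\times p}$, $\tilde N\in H_\infty^{p\times m}$ are left coprime if there are $\tilde X,\tilde Y\in H_\infty$ with $\tilde M\tilde X+\tilde N\tilde Y=I_p$. $P_0$ has coprime factorizations if $P_0=NM^{-1}=\tilde M^{-1}\tilde N$ for some right coprime $M,N$ and left coprime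 $\tilde M,\tilde N$. **Incidence matrix.** $\mathcal G$ is a graph with $\nu$ vertices and $\mu$ (oriented) edges. Its incidence matrix $E\in\mathbb R^{\nu\times\mu}$ has $(i,j)$ entry $1$ if vertex $i$ is the head of edge $j$, $-1$ if vertex $i$ is the tail of edge $j$, and $0$ if vertex $i$ does not belong to edge $j$ (so $\mathbb 1^\top E=0$ with $\mathbb 1$ the all-ones vector). **Diffusively-coupled system.** The aggregate plant is $P=\operatorname{diag}\{P_1,\dots,P_\nu\}$, with each $P_i$ of size $p\times m$. The edge controller is $K_{\mathrm e}=\operatorname{diag}\{K_{\mathrm e,1},\dots,K_{\mathrm e,\mu}\}$, with each $K_{\mathrm e,j}$ of size $m\times p$. The overall controller is $K=(E\otimes I_m)K_{\mathrm e}(E^\top\otimes I_p)$. The closed loop is $y=P(u+d_u)+d_y$, $u=Ky$, with exogenous signals $d_y,d_u$. The system is *internally stable* if the closed-loop map $T_4:(d_y,d_u)\mapsto(y,u)$, $$T_4=\begin{bmatrix} I \\ K \end{bmatrix}(I-PK)^{-1}\begin{bmatrix} I & P \end{bmatrix},$$ is well defined (i.e. $\det(I-PK)\not\equiv0$) and stable (i.e. $T_4\in H_\infty$). The edge controllers *internally stabilize* the system if it is internally stable with these controllers. *)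

theory Defs
  imports
    "HOL-Complex_Analysis.Meromorphic"
    "HOL-Computational_Algebra.Normalized_Fraction"
    "Graph_Theory.Digraph"
    "Jordan_Normal_Form.Gauss_Jordan_Elimination"
    "Jordan_Normal_Form.Determinant"
begin

section \<open>The ring \<open>H\<^sub>\<infinity>\<close> and its quotient field\<close>

definition rhp :: "complex set" where
  "rhp = {s. 0 < Re s}"

lemma rhp_open: "open rhp"
  unfolding rhp_def by (rule open_halfspace_Re_gt)

lemma rhp_connected: "connected rhp"
  unfolding rhp_def by (intro convex_connected convex_halfspace_Re_gt)

lemma rhp_nonempty: "1 \<in> rhp"
  by (simp add: rhp_def)

text \<open>
  HOL functions are total, so a function on the open right half-plane is represented by its
  extension by zero; this makes equality in the type coincide with equality on the half-plane.
\<close>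

typedef hinf = "{f :: complex \<Rightarrow> complex.
    f holomorphic_on rhp \<and> bounded (f ` rhp) \<and> (\<forall>s. s \<notin> rhp \<longrightarrow> f s = 0)}"
  morphisms hinf_eval Abs_hinf
  by (rule exI[of _ "\<lambda>_. 0"]) (auto intro: finite_imp_bounded finite_subset[of _ "{0}"])

setup_lifting type_definition_hinf

lemma hinf_holo: "hinf_eval a holomorphic_on rhp"
  and hinf_bounded: "bounded (hinf_eval a ` rhp)"
  and hinf_outside: "s \<notin> rhp \<Longrightarrow> hinf_eval a s = 0"
  using hinf_eval[of a] by simp_all

lemma hinf_eqI: "(\<And>s. s \<in> rhp \<Longrightarrow> hinf_eval a s = hinf_eval b s) \<Longrightarrow> a = b"
  by (metis ext hinf_eval_inject hinf_outside)

lemma hinf_mult_zero: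
  assumes "\<And>s. hinf_eval a s * hinf_eval b s = 0" and w: "hinf_eval a w \<noteq> 0"
  shows "hinf_eval b z = 0"
proof (cases "z \<in> rhp")
  case True
  let ?S = "{s \<in> rhp. hinf_eval a s \<noteq> 0}"
  have "open (rhp \<inter> hinf_eval a -` (- {0}))"
    by (intro continuous_open_preimage holomorphic_on_imp_continuous_on hinf_holo rhp_open) auto
  then have "open ?S"
    by (simp add: vimage_def Int_def)
  moreover have "w \<in> ?S"
    using w hinf_outside by auto
  moreover have "hinf_eval b s = 0" if "s \<in> ?S" for s
    using that assms(1)[of s] by auto
  ultimately show ?thesis
    using True rhp_connected rhp_open hinf_holo[of b]
    by (intro analytic_continuation_open[of ?S rhp "hinf_eval b" "\<lambda>_. 0" z]) auto
qed (rule hinf_outside)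

instantiation hinf :: idom
begin

lift_definition zero_hinf :: hinf is "\<lambda>_. 0"
  by (auto intro: finite_imp_bounded finite_subset[of _ "{0}"])

lift_definition one_hinf :: hinf is "\<lambda>s. if s \<in> rhp then 1 else 0"
  by (auto intro: finite_imp_bounded finite_subset[of _ "{1}"]
      intro!: holomorphic_on_const[THEN holomorphic_transform])

lift_definition plus_hinf :: "hinf \<Rightarrow> hinf \<Rightarrow> hinf" is "\<lambda>f g s. f s + g s"
  by (auto intro!: holomorphic_intros bounded_plus_comp)

lift_definition minus_hinf :: "hinf \<Rightarrow> hinf \<Rightarrow> hinf" is "\<lambda>f g s. f s - g s"
  by (auto intro!: holomorphic_intros bounded_minus_comp)

lift_definition uminus_hinf :: "hinf \<Rightarrow> hinf" is "\<lambda>f s. - f s"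
  by (auto intro!: holomorphic_intros simp: bounded_iff)

lift_definition times_hinf :: "hinf \<Rightarrow> hinf \<Rightarrow> hinf" is "\<lambda>f g s. f s * g s"
proof -
  fix f g :: "complex \<Rightarrow> complex"
  assume f: "f holomorphic_on rhp \<and> bounded (f ` rhp) \<and> (\<forall>s. s \<notin> rhp \<longrightarrow> f s = 0)"
    and g: "g holomorphic_on rhp \<and> bounded (g ` rhp) \<and> (\<forall>s. s \<notin> rhp \<longrightarrow> g s = 0)"
  obtain A where "\<And>s. s \<in> rhp \<Longrightarrow> norm (f s) \<le> A"
    using f by (auto simp: bounded_iff)
  moreover obtain B where "\<And>s. s \<in> rhp \<Longrightarrow> norm (g s) \<le> B"
    using g by (auto simp: bounded_iff)
  ultimately have "norm (f s * g s) \<le> A * B" if "s \<in> rhp" for s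
    unfolding norm_mult using that by (metis mult_mono' norm_ge_zero)
  then have "bounded ((\<lambda>s. f s * g s) ` rhp)"
    by (auto simp: bounded_iff)
  then show "(\<lambda>s. f s * g s) holomorphic_on rhp \<and> bounded ((\<lambda>s. f s * g s) ` rhp) \<and>
      (\<forall>s. s \<notin> rhp \<longrightarrow> f s * g s = 0)"
    using f g by (auto intro!: holomorphic_intros)
qed

instance
proof
  fix a b c :: hinf
  show "a * b * c = a * (b * c)" by transfer (simp add: mult.assoc)
  show "a * b = b * a" by transfer (simp add: mult.commute)
  show "1 * a = a" by transfer auto
  show "a + b + c = a + (b + c)" by transfer (simp add: add.assoc)
  show "a + b = b + a" by transfer (simp add: add.commute)
  show "0 + a = a" by transfer simp
  show "- a + a = 0" by transfer simp
  show "a - b = a + - b" by transfer simp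
  show "(a + b) * c = a * c + b * c" by transfer (simp add: distrib_right)
  show "a * (b + c) = a * b + a * c" by transfer (simp add: distrib_left)
  show "0 * a = 0" by transfer simp
  show "a * 0 = 0" by transfer simp
  show "(0::hinf) \<noteq> 1" by transfer (metis rhp_nonempty zero_neq_one)
  show "a * b \<noteq> 0" if "a \<noteq> 0" "b \<noteq> 0"
  proof
    assume "a * b = 0"
    then have "hinf_eval a s * hinf_eval b s = 0" for s
      by (metis times_hinf.rep_eq zero_hinf.rep_eq)
    then show False
      using hinf_mult_zero that by (metis hinf_eqI zero_hinf.rep_eq)
  qed
qed

end

type_synonym tf = "hinf fract"

definition stable :: "tf mat \<Rightarrow> bool" where
  "stable A \<longleftrightarrow> elements_mat A \<subseteq> range to_fract"


section \<open>Poles in the closed right half-plane\<close>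

text \<open>
  \<open>tf_extends f U g\<close>: the meromorphic function \<open>g\<close> on \<open>U\<close> agrees with \<open>f\<close> on the part of \<open>U\<close> in
  the open right half-plane, apart from the (isolated) zeros of some denominator of \<open>f\<close>.
\<close>

definition tf_extends :: "tf \<Rightarrow> complex set \<Rightarrow> (complex \<Rightarrow> complex) \<Rightarrow> bool" where
  "tf_extends f U g \<longleftrightarrow> g meromorphic_on U \<and>
     (\<exists>a b. b \<noteq> 0 \<and> f = Fract a b \<and>
        (\<forall>s \<in> U \<inter> rhp. hinf_eval b s \<noteq> 0 \<longrightarrow> g s = hinf_eval a s / hinf_eval b s))"

text \<open>
  Meant for \<open>Re z \<ge> 0\<close> only. If \<open>Re z > 0\<close> the extensions exist automatically and the choice of
  representatives is irrelevant (lemma \<open>has_pole_at_rhp_iff\<close> below); if \<open>Re z = 0\<close> their existence is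
  part of what a pole at \<open>z\<close> means.
\<close>

definition has_pole_at :: "tf mat \<Rightarrow> complex \<Rightarrow> bool" where
  "has_pole_at A z \<longleftrightarrow> (\<exists>U g. open U \<and> z \<in> U \<and>
     (\<forall>i < dim_row A. \<forall>j < dim_col A. tf_extends (A $$ (i, j)) U (g i j)) \<and>
     (\<exists>i < dim_row A. \<exists>j < dim_col A. is_pole (g i j) z))"

lemma hinf_eventually_nonzero:
  assumes "b \<noteq> 0" "z \<in> rhp"
  shows "\<forall>\<^sub>F s in at z. hinf_eval b s \<noteq> 0 \<and> s \<in> rhp"
proof -
  from assms(1) obtain w where w: "w \<in> rhp" "hinf_eval b w \<noteq> 0"
    using hinf_eqI[of b 0] by (auto simp: zero_hinf.rep_eq)
  have "\<forall>\<^sub>F s in at z. hinf_eval b s \<noteq> 0"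
    using non_zero_neighbour_alt[OF hinf_holo rhp_open rhp_connected assms(2) w]
    by (auto elim: eventually_mono)
  moreover have "\<forall>\<^sub>F s in at z. s \<in> rhp"
    using eventually_at_in_open'[OF rhp_open assms(2)] .
  ultimately show ?thesis
    by eventually_elim simp
qed

lemma tf_extends_rhp:
  assumes "tf_extends (Fract a b) U g" "b \<noteq> 0" "open U" "z \<in> U" "z \<in> rhp"
  shows "\<forall>\<^sub>F s in at z. g s = hinf_eval a s / hinf_eval b s"
proof -
  obtain c d where cd: "d \<noteq> 0" "Fract a b = Fract c d"
    and g: "\<forall>s \<in> U \<inter> rhp. hinf_eval d s \<noteq> 0 \<longrightarrow> g s = hinf_eval c s / hinf_eval d s"
    using assms(1) unfolding tf_extends_def by blast
  have "a * d = c * b"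
    using cd assms(2) by (simp add: eq_fract)
  then have eq: "hinf_eval a s * hinf_eval d s = hinf_eval c s * hinf_eval b s" for s
    by (metis times_hinf.rep_eq)
  have "\<forall>\<^sub>F s in at z. s \<in> U"
    using eventually_at_in_open'[OF assms(3,4)] .
  with hinf_eventually_nonzero[OF assms(2,5)] hinf_eventually_nonzero[OF cd(1) assms(5)]
  show ?thesis
  proof eventually_elim
    case (elim s)
    with g eq[of s] show ?case by (simp add: frac_eq_eq)
  qed
qed

lemma tf_extends_exists:
  assumes "b \<noteq> 0"
  shows "tf_extends (Fract a b) rhp (\<lambda>s. hinf_eval a s / hinf_eval b s)"
proof -
  have "(\<lambda>s. hinf_eval a s / hinf_eval b s) meromorphic_on rhp"
    by (intro meromorphic_intros analytic_on_imp_meromorphic_on)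
       (auto simp: analytic_on_open rhp_open hinf_holo)
  then show ?thesis
    using assms unfolding tf_extends_def by blast
qed

lemma has_pole_at_rhp_iff:
  assumes "z \<in> rhp"
    and rep: "\<And>i j. i < dim_row A \<Longrightarrow> j < dim_col A \<Longrightarrow>
      b i j \<noteq> 0 \<and> A $$ (i, j) = Fract (a i j) (b i j)"
  shows "has_pole_at A z \<longleftrightarrow> (\<exists>i < dim_row A. \<exists>j < dim_col A.
      is_pole (\<lambda>s. hinf_eval (a i j) s / hinf_eval (b i j) s) z)"
proof
  assume "has_pole_at A z"
  then obtain U g i j where *: "open U" "z \<in> U" "i < dim_row A" "j < dim_col A"
    "tf_extends (A $$ (i, j)) U (g i j)" "is_pole (g i j) z"
    unfolding has_pole_at_def by blast
  then have "\<forall>\<^sub>F s in at z. g i j s = hinf_eval (a i j) s / hinf_eval (b i j) s"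
    using rep[of i j] assms(1) by (intro tf_extends_rhp[of _ _ U]) auto
  then have "is_pole (\<lambda>s. hinf_eval (a i j) s / hinf_eval (b i j) s) z"
    using *(6) by (simp cong: is_pole_cong)
  then show "\<exists>i < dim_row A. \<exists>j < dim_col A.
      is_pole (\<lambda>s. hinf_eval (a i j) s / hinf_eval (b i j) s) z"
    using * by blast
next
  assume "\<exists>i < dim_row A. \<exists>j < dim_col A.
      is_pole (\<lambda>s. hinf_eval (a i j) s / hinf_eval (b i j) s) z"
  then show "has_pole_at A z"
    unfolding has_pole_at_def using rep tf_extends_exists assms(1) rhp_open
    by (intro exI[of _ rhp] exI[of _ "\<lambda>i j s. hinf_eval (a i j) s / hinf_eval (b i j) s"]) auto
qed


section \<open>Coprime factorizations\<close>

definition right_coprime :: "hinf mat \<Rightarrow> hinf mat \<Rightarrow> bool" where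
  "right_coprime M N \<longleftrightarrow> (\<exists>m p. M \<in> carrier_mat m m \<and> N \<in> carrier_mat p m \<and>
     (\<exists>X \<in> carrier_mat m m. \<exists>Y \<in> carrier_mat m p. X * M + Y * N = 1\<^sub>m m))"

definition left_coprime :: "hinf mat \<Rightarrow> hinf mat \<Rightarrow> bool" where
  "left_coprime M N \<longleftrightarrow> (\<exists>p m. M \<in> carrier_mat p p \<and> N \<in> carrier_mat p m \<and>
     (\<exists>X \<in> carrier_mat p p. \<exists>Y \<in> carrier_mat m p. M * X + N * Y = 1\<^sub>m p))"

abbreviation tf_mat :: "hinf mat \<Rightarrow> tf mat" where
  "tf_mat \<equiv> map_mat to_fract"

text \<open>Only used for square matrices with nonzero determinant.\<close>

abbreviation mat_inv :: "'a :: field mat \<Rightarrow> 'a mat" where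
  "mat_inv A \<equiv> the (mat_inverse A)"

definition has_coprime_factorizations :: "tf mat \<Rightarrow> bool" where
  "has_coprime_factorizations P \<longleftrightarrow>
     (\<exists>M N. right_coprime M N \<and> Determinant.det (tf_mat M) \<noteq> 0 \<and>
        P = tf_mat N * mat_inv (tf_mat M)) \<and>
     (\<exists>M N. left_coprime M N \<and> Determinant.det (tf_mat M) \<noteq> 0 \<and>
        P = mat_inv (tf_mat M) * tf_mat N)"


section \<open>Diffusively coupled systems\<close>

text \<open>
  Vertices and edges are numbered from 0. The incidence matrix is taken directly over the field of
  transfer functions; its entries are integers, so its conjugate transpose is its transpose.
\<close>

definition incidence_mat :: "nat \<Rightarrow> nat \<Rightarrow> (nat, nat) pre_digraph \<Rightarrow> 'a :: ring_1 mat" where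
  "incidence_mat \<nu> \<mu> G = Matrix.mat \<nu> \<mu>
     (\<lambda>(i, j). if i = head G j then 1 else if i = tail G j then - 1 else 0)"

definition kronecker :: "'a :: times mat \<Rightarrow> 'a mat \<Rightarrow> 'a mat" (infixl "\<otimes>\<^sub>K" 70) where
  "A \<otimes>\<^sub>K B = Matrix.mat (dim_row A * dim_row B) (dim_col A * dim_col B)
     (\<lambda>(i, j). A $$ (i div dim_row B, j div dim_col B) * B $$ (i mod dim_row B, j mod dim_col B))"

definition block_diag :: "nat \<Rightarrow> (nat \<Rightarrow> 'a :: zero mat) \<Rightarrow> 'a mat" where
  "block_diag n A = diag_block_mat (map A [0..<n])"

definition diffusive_controller ::
  "nat \<Rightarrow> nat \<Rightarrow> (nat, nat) pre_digraph \<Rightarrow> nat \<Rightarrow> nat \<Rightarrow> (nat \<Rightarrow> tf mat) \<Rightarrow> tf mat" where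
  "diffusive_controller \<nu> \<mu> G p m Ke =
     (incidence_mat \<nu> \<mu> G \<otimes>\<^sub>K 1\<^sub>m m) * block_diag \<mu> Ke *
     (transpose_mat (incidence_mat \<nu> \<mu> G) \<otimes>\<^sub>K 1\<^sub>m p)"

definition append_cols :: "'a :: zero mat \<Rightarrow> 'a mat \<Rightarrow> 'a mat" (infixr "@\<^sub>c" 65) where
  "A @\<^sub>c B = four_block_mat A B (0\<^sub>m 0 (dim_col A)) (0\<^sub>m 0 (dim_col B))"

definition closed_loop :: "tf mat \<Rightarrow> tf mat \<Rightarrow> tf mat" where
  "closed_loop P K =
     (1\<^sub>m (dim_row P) @\<^sub>r K) * mat_inv (1\<^sub>m (dim_row P) - P * K) * (1\<^sub>m (dim_row P) @\<^sub>c P)"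

definition internally_stable :: "tf mat \<Rightarrow> tf mat \<Rightarrow> bool" where
  "internally_stable P K \<longleftrightarrow>
     Determinant.det (1\<^sub>m (dim_row P) - P * K) \<noteq> 0 \<and> stable (closed_loop P K)"

end

(*
  The all-ones row J satisfies J E = 0, hence (J \<otimes> I) K = 0. As the agents are homogeneous,
  (J \<otimes> I) P = P0 (J \<otimes> I), so (J \<otimes> I) (I - P K) = J \<otimes> I and therefore
  (J \<otimes> I) (I - P K)^-1 P = J \<otimes> P0: the diffusive feedback is invisible to the sum of the
  agents. Since (I - P K)^-1 P is a block of the closed loop, internal stability forces the
  entries of P0 into H_infinity, and a function bounded on the open right half-plane has no pole
  in its closure.
*)
theory Submission
  imports Defs
begin

section \<open>Kronecker products\<close>

lemma kronecker_carrier [simp]: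
  "A \<in> carrier_mat a b \<Longrightarrow> B \<in> carrier_mat c d \<Longrightarrow> A \<otimes>\<^sub>K B \<in> carrier_mat (a * c) (b * d)"
  by (auto simp: kronecker_def)

lemma index_kronecker:
  assumes "A \<in> carrier_mat a b" "B \<in> carrier_mat c d" "i < a * c" "j < b * d"
  shows "(A \<otimes>\<^sub>K B) $$ (i, j) = A $$ (i div c, j div d) * B $$ (i mod c, j mod d)"
  using assms by (auto simp: kronecker_def)

lemma div_mod_less:
  fixes i a c :: nat
  assumes "i < a * c"
  shows "i div c < a" "i mod c < c"
  using assms by (cases "c = 0"; simp add: less_mult_imp_div_less)+

text \<open>Division with remainder matches \<open>k\<close> with the pair of its quotient and
  remainder by \<open>c\<close>. This splits the inner index of a product of Kronecker products into
  a block number and a position in the block.\<close>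

lemma sum_div_mod:
  fixes f :: "nat \<Rightarrow> nat \<Rightarrow> 'a :: comm_monoid_add"
  shows "(\<Sum>k<a * c. f (k div c) (k mod c)) = (\<Sum>x<a. \<Sum>y<c. f x y)"
proof -
  have "(\<Sum>k<a * c. f (k div c) (k mod c)) = (\<Sum>(x, y)\<in>{..<a} \<times> {..<c}. f x y)"
  proof (rule sum.reindex_bij_witness[where i = "\<lambda>(x, y). x * c + y"
        and j = "\<lambda>k. (k div c, k mod c)"])
    fix xy assume "xy \<in> {..<a} \<times> {..<c}"
    then obtain x y where "xy = (x, y)" "x < a" "y < c" by auto
    moreover from this have "x * c + y < Suc x * c" by simp
    moreover have "Suc x * c \<le> a * c" using \<open>x < a\<close> by (intro mult_le_mono1) simp
    ultimately show "(case xy of (x, y) \<Rightarrow> x * c + y) \<in> {..<a * c}" by simp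
  qed (auto simp: div_mod_less)
  then show ?thesis
    by (simp add: sum.cartesian_product)
qed

text \<open>The mixed-product rule. All later block computations reduce to it, so that entries need
  not be inspected again.\<close>

lemma kronecker_mult:
  fixes A B C D :: "'a :: comm_ring_1 mat"
  assumes A: "A \<in> carrier_mat a b" and B: "B \<in> carrier_mat c d"
    and C: "C \<in> carrier_mat b e" and D: "D \<in> carrier_mat d f"
  shows "(A \<otimes>\<^sub>K B) * (C \<otimes>\<^sub>K D) = (A * C) \<otimes>\<^sub>K (B * D)"
proof (rule eq_matI)
  fix i j
  assume "i < dim_row ((A * C) \<otimes>\<^sub>K (B * D))" "j < dim_col ((A * C) \<otimes>\<^sub>K (B * D))"
  with A B C D have ij: "i < a * c" "j < e * f"
    by (auto simp: kronecker_def)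
  note b = div_mod_less[OF ij(1)] div_mod_less[OF ij(2)]
  have "((A \<otimes>\<^sub>K B) * (C \<otimes>\<^sub>K D)) $$ (i, j)
      = (\<Sum>k<b * d. (A \<otimes>\<^sub>K B) $$ (i, k) * (C \<otimes>\<^sub>K D) $$ (k, j))"
    using ij kronecker_carrier[OF A B] kronecker_carrier[OF C D]
    by (simp add: scalar_prod_def atLeast0LessThan del: kronecker_carrier)
  also have "\<dots> = (\<Sum>k<b * d. (A $$ (i div c, k div d) * B $$ (i mod c, k mod d)) *
      (C $$ (k div d, j div f) * D $$ (k mod d, j mod f)))"
    by (intro sum.cong refl)
      (simp add: index_kronecker[OF A B ij(1)] index_kronecker[OF C D _ ij(2)])
  also have "\<dots> = (\<Sum>x<b. \<Sum>y<d. (A $$ (i div c, x) * B $$ (i mod c, y)) *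
      (C $$ (x, j div f) * D $$ (y, j mod f)))"
    by (rule sum_div_mod)
  \<comment> \<open>Commutativity of the entries moves the factors of \<open>B\<close> past those of
    \<open>C\<close>, so the double sum separates.\<close>
  also have "\<dots> = (\<Sum>x<b. A $$ (i div c, x) * C $$ (x, j div f)) *
      (\<Sum>y<d. B $$ (i mod c, y) * D $$ (y, j mod f))"
    by (simp add: sum_product algebra_simps)
  also have "\<dots> = (A * C) $$ (i div c, j div f) * (B * D) $$ (i mod c, j mod f)"
    using A B C D b by (simp add: scalar_prod_def atLeast0LessThan)
  also have "\<dots> = ((A * C) \<otimes>\<^sub>K (B * D)) $$ (i, j)"
    by (rule index_kronecker[symmetric, OF mult_carrier_mat[OF A C] mult_carrier_mat[OF B D] ij])
  finally show "((A \<otimes>\<^sub>K B) * (C \<otimes>\<^sub>K D)) $$ (i, j) = ((A * C) \<otimes>\<^sub>K (B * D)) $$ (i, j)" .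
qed (use A B C D in \<open>auto simp: kronecker_def\<close>)

lemma kronecker_zero_left:
  fixes B :: "'a :: semiring_0 mat"
  assumes "B \<in> carrier_mat c d"
  shows "0\<^sub>m a b \<otimes>\<^sub>K B = 0\<^sub>m (a * c) (b * d)"
  using assms by (intro eq_matI) (auto simp: kronecker_def div_mod_less)

text \<open>Puts the homogeneous plant into Kronecker form, where the mixed-product rule
  applies.\<close>

lemma block_diag_const:
  fixes A :: "'a :: semiring_1 mat"
  assumes A: "A \<in> carrier_mat p m"
  shows "block_diag n (\<lambda>_. A) = 1\<^sub>m n \<otimes>\<^sub>K A"
proof (induction n)
  case 0
  show ?case
    by (rule eq_matI) (auto simp: block_diag_def kronecker_def)
next
  case (Suc n)
  \<comment> \<open>As all blocks are equal, the additional one may be placed in front, where the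
    recursion of \<open>diag_block_mat\<close> peels it off.\<close>
  have eq: "map (\<lambda>_. A) [0..<Suc n] = A # map (\<lambda>_. A) [0..<n]"
    by (simp add: map_replicate_const del: upt_Suc)
  have "block_diag (Suc n) (\<lambda>_. A)
      = four_block_mat A (0\<^sub>m p (n * m)) (0\<^sub>m (n * p) m) (1\<^sub>m n \<otimes>\<^sub>K A)"
    using A unfolding block_diag_def eq
    by (simp add: Let_def Suc[unfolded block_diag_def] kronecker_def)
  also have "\<dots> = 1\<^sub>m (Suc n) \<otimes>\<^sub>K A"
  proof (rule eq_matI)
    fix i j
    assume "i < dim_row (1\<^sub>m (Suc n) \<otimes>\<^sub>K A)" "j < dim_col (1\<^sub>m (Suc n) \<otimes>\<^sub>K A)"
    with A have ij: "i < Suc n * p" "j < Suc n * m"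
      by (auto simp: kronecker_def)
    then have pm: "p > 0" "m > 0"
      by (auto intro: gr0I)
    \<comment> \<open>Beyond the first block, dropping it lowers the block number by one and keeps
      the position in the block. The bound \<open>i div p \<ge> 1\<close> keeps the natural
      subtraction from truncating.\<close>
    have "(i - p) div p = i div p - 1 \<and> (i - p) mod p = i mod p \<and> i div p \<ge> 1" if "\<not> i < p"
      using that pm by (simp add: le_div_geq le_mod_geq)
    moreover have "(j - m) div m = j div m - 1 \<and> (j - m) mod m = j mod m \<and> j div m \<ge> 1"
      if "\<not> j < m"
      using that pm by (simp add: le_div_geq le_mod_geq)
    moreover note div_mod_less[OF ij(1)] div_mod_less[OF ij(2)]
    ultimately show "four_block_mat A (0\<^sub>m p (n * m)) (0\<^sub>m (n * p) m) (1\<^sub>m n \<otimes>\<^sub>K A) $$ (i, j)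
        = (1\<^sub>m (Suc n) \<otimes>\<^sub>K A) $$ (i, j)"
      using A ij pm by (auto simp: kronecker_def)
  qed (use A in \<open>auto simp: kronecker_def\<close>)
  finally show ?case .
qed

lemma block_diag_carrier:
  assumes "\<And>i. i < n \<Longrightarrow> A i \<in> carrier_mat a b"
  shows "block_diag n A \<in> carrier_mat (n * a) (n * b)"
proof
  have "map (dim_row \<circ> A) [0..<n] = replicate n a" "map (dim_col \<circ> A) [0..<n] = replicate n b"
    using carrier_matD[OF assms] by (auto intro!: nth_equalityI)
  then show "dim_row (block_diag n A) = n * a" "dim_col (block_diag n A) = n * b"
    by (simp_all add: block_diag_def dim_diag_block_mat sum_list_replicate)
qed


section \<open>Diffusive controllers\<close>

text \<open>The transposed all-ones vector, encoded as a matrix with one row so that it can be a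
  Kronecker factor.\<close>

definition ones_row :: "nat \<Rightarrow> 'a :: one mat" where
  "ones_row n = Matrix.mat 1 n (\<lambda>_. 1)"

lemma ones_row_carrier [simp]: "ones_row n \<in> carrier_mat 1 n"
  by (simp add: ones_row_def)

lemma incidence_mat_carrier [simp]: "incidence_mat \<nu> \<mu> G \<in> carrier_mat \<nu> \<mu>"
  by (simp add: incidence_mat_def)

text \<open>Each column of the incidence matrix holds a single 1 and a single -1, at different
  vertices because there are no loops.\<close>

lemma ones_row_mult_incidence_mat:
  assumes "loopfree_digraph G" "verts G = {..<\<nu>}" "arcs G = {..<\<mu>}"
  shows "ones_row \<nu> * incidence_mat \<nu> \<mu> G = (0\<^sub>m 1 \<mu> :: 'a :: comm_ring_1 mat)"
proof (rule eq_matI)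
  interpret loopfree_digraph G by fact
  fix i j assume "i < dim_row (0\<^sub>m 1 \<mu> :: 'a mat)" "j < dim_col (0\<^sub>m 1 \<mu> :: 'a mat)"
  then have i: "i = 0" and j: "j < \<mu>" by auto
  have ht: "head G j < \<nu>" "tail G j < \<nu>" "tail G j \<noteq> head G j"
    using j assms head_in_verts[of j] tail_in_verts[of j] no_loops[of j] by auto
  have "(ones_row \<nu> * incidence_mat \<nu> \<mu> G) $$ (i, j)
      = (\<Sum>k<\<nu>. if k = head G j then 1 else if k = tail G j then - 1 else 0 :: 'a)"
    using i j by (simp add: ones_row_def incidence_mat_def scalar_prod_def atLeast0LessThan)
  \<comment> \<open>The nested conditional is a difference of two indicators only because head and
    tail differ.\<close>
  also have "\<dots> = (\<Sum>k<\<nu>. (if k = head G j then 1 else 0) - (if k = tail G j then 1 else 0))"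
    using ht(3) by (intro sum.cong) auto
  also have "\<dots> = 0"
    using ht by (simp add: sum_subtractf)
  finally show "(ones_row \<nu> * incidence_mat \<nu> \<mu> G) $$ (i, j) = (0\<^sub>m 1 \<mu> :: 'a mat) $$ (i, j)"
    using i j by simp
qed (auto simp: ones_row_def incidence_mat_def)

lemma diffusive_controller_carrier:
  assumes "\<And>j. j < \<mu> \<Longrightarrow> Ke j \<in> carrier_mat m p"
  shows "diffusive_controller \<nu> \<mu> G p m Ke \<in> carrier_mat (\<nu> * m) (\<nu> * p)"
  unfolding diffusive_controller_def
  by (intro mult_carrier_mat[of _ _ "\<mu> * p"] mult_carrier_mat[of _ _ "\<mu> * m"]
      kronecker_carrier block_diag_carrier assms) auto

text \<open>The all-ones row already annihilates the leftmost factor, so the control inputs sum to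
  zero over the agents whatever the edge controllers are.\<close>

lemma ones_row_mult_diffusive_controller:
  assumes G: "loopfree_digraph G" "verts G = {..<\<nu>}" "arcs G = {..<\<mu>}"
    and Ke: "\<And>j. j < \<mu> \<Longrightarrow> Ke j \<in> carrier_mat m p"
  shows "(ones_row \<nu> \<otimes>\<^sub>K 1\<^sub>m m) * diffusive_controller \<nu> \<mu> G p m Ke = 0\<^sub>m m (\<nu> * p)"
proof -
  let ?J = "ones_row \<nu> \<otimes>\<^sub>K 1\<^sub>m m :: tf mat"
  let ?E = "incidence_mat \<nu> \<mu> G \<otimes>\<^sub>K 1\<^sub>m m :: tf mat"
  let ?F = "transpose_mat (incidence_mat \<nu> \<mu> G) \<otimes>\<^sub>K 1\<^sub>m p :: tf mat"
  have J: "?J \<in> carrier_mat m (\<nu> * m)"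
    using kronecker_carrier[OF ones_row_carrier one_carrier_mat] by simp
  have E: "?E \<in> carrier_mat (\<nu> * m) (\<mu> * m)"
    by (intro kronecker_carrier) auto
  have F: "?F \<in> carrier_mat (\<mu> * p) (\<nu> * p)"
    by (intro kronecker_carrier) auto
  have B: "block_diag \<mu> Ke \<in> carrier_mat (\<mu> * m) (\<mu> * p)"
    by (intro block_diag_carrier Ke)
  have "?J * ?E = 0\<^sub>m m (\<mu> * m)"
    by (simp add: kronecker_mult[OF ones_row_carrier one_carrier_mat incidence_mat_carrier one_carrier_mat]
        ones_row_mult_incidence_mat[OF G] kronecker_zero_left[OF one_carrier_mat])
  moreover have "?J * (?E * block_diag \<mu> Ke * ?F) = (?J * ?E) * block_diag \<mu> Ke * ?F"
    by (simp only: assoc_mult_mat[OF J mult_carrier_mat[OF E B] F] assoc_mult_mat[OF J E B])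
  ultimately show ?thesis
    using B F by (simp add: diffusive_controller_def)
qed


section \<open>Stability\<close>

lemma to_fract_sum_closed:
  "(\<And>k. k \<in> S \<Longrightarrow> f k \<in> range to_fract) \<Longrightarrow> sum f S \<in> range to_fract"
proof (induction S rule: infinite_finite_induct)
  case (insert x F)
  then obtain a b where "f x = to_fract a" "sum f F = to_fract b" by (metis imageE insertCI)
  with insert have "sum f (insert x F) = to_fract (a + b)" by simp
  then show ?case by blast
\<comment> \<open>The remaining index sets are empty or infinite, and over both the sum is
  0.\<close>
qed (auto intro: range_eqI[of _ _ 0])

lemma to_fract_mult_closed:
  "a \<in> range to_fract \<Longrightarrow> b \<in> range to_fract \<Longrightarrow> a * b \<in> range to_fract"
  by (auto simp flip: to_fract_mult)

lemma stable_iff: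
  "stable A \<longleftrightarrow> (\<forall>i < dim_row A. \<forall>j < dim_col A. A $$ (i, j) \<in> range to_fract)"
  unfolding stable_def elements_mat_def by (force simp: image_subset_iff)

lemma stable_mult:
  assumes "stable A" "stable B" "dim_col A = dim_row B"
  shows "stable (A * B)"
  unfolding stable_iff
proof (intro allI impI)
  fix i j assume "i < dim_row (A * B)" "j < dim_col (A * B)"
  then have "(A * B) $$ (i, j) = (\<Sum>k<dim_row B. A $$ (i, k) * B $$ (k, j))"
    using assms(3) by (simp add: scalar_prod_def atLeast0LessThan)
  also have "\<dots> \<in> range to_fract"
    using assms \<open>i < dim_row (A * B)\<close> \<open>j < dim_col (A * B)\<close>
    by (intro to_fract_sum_closed to_fract_mult_closed) (auto simp: stable_iff)
  finally show "(A * B) $$ (i, j) \<in> range to_fract" .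
qed

lemma stable_ones_row_kronecker: "stable (ones_row n \<otimes>\<^sub>K 1\<^sub>m k)"
proof -
  have "0 \<in> range to_fract" "1 \<in> range to_fract"
    using range_eqI[of 0 to_fract 0] range_eqI[of 1 to_fract 1] by auto
  then show ?thesis
    by (auto simp: stable_iff kronecker_def ones_row_def div_mod_less)
qed

text \<open>The product is \<open>n\<close> copies of \<open>A\<close> side by side; for
  \<open>n \<ge> 1\<close> the first copy can be read off.\<close>

lemma stable_of_ones_row_kronecker:
  assumes "stable (ones_row n \<otimes>\<^sub>K A)" "n \<ge> 1"
  shows "stable A"
  unfolding stable_iff
proof (intro allI impI)
  fix i j assume ij: "i < dim_row A" "j < dim_col A"
  have "dim_col A \<le> n * dim_col A"
    using assms(2) by simp
  with ij have "j < n * dim_col A" by linarith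
  with ij assms have "(ones_row n \<otimes>\<^sub>K A) $$ (i, j) = A $$ (i, j)"
    by (simp add: kronecker_def ones_row_def)
  moreover have "dim_row (ones_row n \<otimes>\<^sub>K A) = dim_row A" "dim_col (ones_row n \<otimes>\<^sub>K A) = n * dim_col A"
    by (simp_all add: kronecker_def ones_row_def)
  then have "(ones_row n \<otimes>\<^sub>K A) $$ (i, j) \<in> range to_fract"
    using assms(1) ij \<open>j < n * dim_col A\<close> unfolding stable_iff by metis
  ultimately show "A $$ (i, j) \<in> range to_fract" by simp
qed

section \<open>Inverses and blocks of the closed loop\<close>

lemma mat_inv_carrier_mult:
  fixes A :: "'a :: field mat"
  assumes A: "A \<in> carrier_mat n n" and d: "Determinant.det A \<noteq> 0"
  shows "mat_inv A \<in> carrier_mat n n" "A * mat_inv A = 1\<^sub>m n"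
proof -
  \<comment> \<open>A nonzero determinant makes \<open>A\<close> a unit of the matrix ring, which
    excludes the result \<open>None\<close>.\<close>
  obtain B where "mat_inverse A = Some B"
    using mat_inverse(1)[OF A, where b = "()"] det_non_zero_imp_unit[OF A d, where b = "()"]
    by (cases "mat_inverse A") auto
  with mat_inverse(2)[OF A this] show "mat_inv A \<in> carrier_mat n n" "A * mat_inv A = 1\<^sub>m n"
    by auto
qed

text \<open>This is the block of the closed loop that maps \<open>d_u\<close> to \<open>y\<close>;
  its entries are among those of the whole matrix.\<close>

lemma stable_closed_loop_upper_right:
  assumes P: "P \<in> carrier_mat a b" and K: "K \<in> carrier_mat b a"
    and Z: "mat_inv (1\<^sub>m a - P * K) \<in> carrier_mat a a"
    and st: "stable (closed_loop P K)"
  shows "stable (mat_inv (1\<^sub>m a - P * K) * P)"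
proof -
  define Z where "Z = mat_inv (1\<^sub>m a - P * K)"
  have Zc: "Z \<in> carrier_mat a a" using Z by (simp add: Z_def)
  define L where "L = (1\<^sub>m a @\<^sub>r K) * Z"
  define R where "R = (1\<^sub>m a @\<^sub>c P)"
  have Lc: "L \<in> carrier_mat (a + b) a"
    unfolding L_def using K Zc by (intro mult_carrier_mat[of _ _ a] carrier_append_rows) auto
  have Rc: "R \<in> carrier_mat a (a + b)"
    using P by (auto simp: R_def append_cols_def)
  have cl: "closed_loop P K = L * R"
    using P by (simp add: closed_loop_def L_def R_def Z_def)
  \<comment> \<open>The top rows of the left factor are unit vectors, so they select rows of the
    inverse.\<close>
  have L: "row L i = row Z i" if i: "i < a" for i
  proof (rule eq_vecI)
    fix j assume "j < dim_vec (row Z i)"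
    with Zc have j: "j < a" by simp
    have "row (1\<^sub>m a @\<^sub>r K) i = unit_vec a i"
      using i K by (auto simp: append_rows_def intro!: eq_vecI)
    with i j K Zc show "row L i $ j = row Z i $ j"
      by (simp add: L_def append_rows_def scalar_prod_left_unit)
  qed (use Lc Zc in auto)
  have R: "col R (a + j) = col P j" if "j < b" for j
    using that P by (auto simp: R_def append_cols_def intro!: eq_vecI)
  have "(Z * P) $$ (i, j) = (L * R) $$ (i, a + j)" if "i < a" "j < b" for i j
    using that Lc Rc Zc P L R by simp
  moreover have "(L * R) $$ (i, a + j) \<in> range to_fract" if "i < a" "j < b" for i j
    using st that Lc Rc unfolding cl stable_iff by auto
  ultimately show ?thesis
    using Zc P unfolding stable_iff Z_def[symmetric] by auto
qed

lemma stable_agent_of_internally_stable: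
  fixes P0 :: "tf mat"
  assumes n: "\<nu> \<ge> 1"
    and G: "loopfree_digraph G" "verts G = {..<\<nu>}" "arcs G = {..<\<mu>}"
    and P0: "P0 \<in> carrier_mat p m"
    and Ke: "\<And>j. j < \<mu> \<Longrightarrow> Ke j \<in> carrier_mat m p"
    and st: "internally_stable (block_diag \<nu> (\<lambda>_. P0)) (diffusive_controller \<nu> \<mu> G p m Ke)"
  shows "stable P0"
proof -
  define P where "P = block_diag \<nu> (\<lambda>_. P0)"
  define K where "K = diffusive_controller \<nu> \<mu> G p m Ke"
  define W :: "tf mat" where "W = ones_row \<nu> \<otimes>\<^sub>K 1\<^sub>m p"
  define V :: "tf mat" where "V = ones_row \<nu> \<otimes>\<^sub>K 1\<^sub>m m"
  define Z where "Z = mat_inv (1\<^sub>m (\<nu> * p) - P * K)"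
  have P: "P \<in> carrier_mat (\<nu> * p) (\<nu> * m)"
    unfolding P_def using P0 by (intro block_diag_carrier)
  have K: "K \<in> carrier_mat (\<nu> * m) (\<nu> * p)"
    unfolding K_def using Ke by (intro diffusive_controller_carrier)
  have W: "W \<in> carrier_mat p (\<nu> * p)" and V: "V \<in> carrier_mat m (\<nu> * m)"
    using kronecker_carrier[OF ones_row_carrier one_carrier_mat] by (simp_all add: W_def V_def)
  have PK: "P * K \<in> carrier_mat (\<nu> * p) (\<nu> * p)" using P K by simp
  have S: "1\<^sub>m (\<nu> * p) - P * K \<in> carrier_mat (\<nu> * p) (\<nu> * p)"
    using PK by (rule minus_carrier_mat)
  have det: "Determinant.det (1\<^sub>m (\<nu> * p) - P * K) \<noteq> 0" and cl: "stable (closed_loop P K)"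
    using st P unfolding internally_stable_def P_def[symmetric] K_def[symmetric] by auto
  have Z: "Z \<in> carrier_mat (\<nu> * p) (\<nu> * p)" and SZ: "(1\<^sub>m (\<nu> * p) - P * K) * Z = 1\<^sub>m (\<nu> * p)"
    unfolding Z_def using mat_inv_carrier_mult[OF S det] by auto
  have one: "ones_row \<nu> * 1\<^sub>m \<nu> = (ones_row \<nu> :: tf mat)"
    by (rule right_mult_one_mat[OF ones_row_carrier])
  have one_P0: "1\<^sub>m p * P0 = P0" using P0 by simp
  \<comment> \<open>\<open>W\<close> sums the agents' outputs and \<open>V\<close> their inputs.
    Homogeneity lets the summation pass through the plant: \<open>W * P\<close> is \<open>P0\<close>
    applied after \<open>V\<close>.\<close>
  have WP: "W * P = ones_row \<nu> \<otimes>\<^sub>K P0"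
    unfolding W_def P_def block_diag_const[OF P0]
    by (simp only: kronecker_mult[OF ones_row_carrier one_carrier_mat one_carrier_mat P0] one one_P0)
  have "(1\<^sub>m 1 \<otimes>\<^sub>K P0) * V = ones_row \<nu> \<otimes>\<^sub>K P0"
    unfolding V_def kronecker_mult[OF one_carrier_mat P0 ones_row_carrier one_carrier_mat]
      right_mult_one_mat[OF P0] left_mult_one_mat[OF ones_row_carrier] ..
  with WP have WPV: "W * P = (1\<^sub>m 1 \<otimes>\<^sub>K P0) * V" by simp
  have P1: "1\<^sub>m 1 \<otimes>\<^sub>K P0 \<in> carrier_mat p m"
    using kronecker_carrier[OF one_carrier_mat P0, of 1] by simp
  \<comment> \<open>Reassociating brings \<open>V\<close> next to \<open>K\<close>, where the
    product vanishes.\<close>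
  have "W * (P * K) = (1\<^sub>m 1 \<otimes>\<^sub>K P0) * (V * K)"
    by (simp only: assoc_mult_mat[OF W P K, symmetric] WPV assoc_mult_mat[OF P1 V K])
  also have "V * K = 0\<^sub>m m (\<nu> * p)"
    unfolding V_def K_def using ones_row_mult_diffusive_controller[OF G Ke] .
  finally have WPK: "W * (P * K) = 0\<^sub>m p (\<nu> * p)"
    using P1 by simp
  have "W * (1\<^sub>m (\<nu> * p) - P * K) = W"
    unfolding mult_minus_distrib_mat[OF W one_carrier_mat PK] WPK right_mult_one_mat[OF W]
    using W by (intro eq_matI) auto
  \<comment> \<open>\<open>W\<close> is fixed by right multiplication with \<open>I - P K\<close>,
    hence also with its right inverse \<open>Z\<close>.\<close>
  then have "W * Z = W"
    using SZ assoc_mult_mat[OF W S Z] W by simp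
  then have "W * (Z * P) = ones_row \<nu> \<otimes>\<^sub>K P0"
    using WP assoc_mult_mat[OF W Z P] by simp
  moreover have "stable (W * (Z * P))"
  proof (rule stable_mult)
    show "stable (Z * P)"
      using stable_closed_loop_upper_right[OF P K _ cl] Z by (simp add: Z_def)
  qed (use W Z in \<open>auto simp: W_def stable_ones_row_kronecker\<close>)
  ultimately show ?thesis
    using stable_of_ones_row_kronecker n by metis
qed

section \<open>Stable transfer functions and poles\<close>

text \<open>Near a pole \<open>g\<close> would exceed every bound, yet in the open half-plane it
  agrees with the bounded function \<open>c\<close> off the zeros of a denominator. Every
  neighbourhood of \<open>z\<close> meets that half-plane, even when \<open>z\<close> is on the
  imaginary axis.\<close>

lemma no_pole_if_tf_extends_to_fract:
  assumes ext: "tf_extends (to_fract c) U g" and U: "open U" "z \<in> U" and z: "Re z \<ge> 0"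
  shows "\<not> is_pole g z"
proof
  assume pole: "is_pole g z"
  obtain a b where b: "b \<noteq> 0" "to_fract c = Fract a b"
    and g: "\<And>s. s \<in> U \<Longrightarrow> s \<in> rhp \<Longrightarrow> hinf_eval b s \<noteq> 0 \<Longrightarrow> g s = hinf_eval a s / hinf_eval b s"
    using ext unfolding tf_extends_def by blast
  \<comment> \<open>The representative \<open>a\<close>, \<open>b\<close> need not have denominator
    1, but \<open>b\<close> cancels wherever it is nonzero.\<close>
  have "a = c * b"
    using b by (simp add: to_fract_def eq_fract)
  with g have gc: "g s = hinf_eval c s" if "s \<in> U" "s \<in> rhp" "hinf_eval b s \<noteq> 0" for s
    using that by (simp add: times_hinf.rep_eq)
  obtain B where B: "\<And>s. s \<in> rhp \<Longrightarrow> norm (hinf_eval c s) \<le> B"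
    using hinf_bounded[of c] by (auto simp: bounded_iff)
  have "\<forall>\<^sub>F s in at z. B < norm (g s)"
    using pole unfolding is_pole_def filterlim_at_infinity_conv_norm_at_top filterlim_at_top_dense
    by blast
  then have "\<forall>\<^sub>F s in at z. B < norm (g s) \<and> s \<in> U"
    using eventually_at_in_open'[OF U] by eventually_elim simp
  then obtain e where e: "e > 0"
    "\<And>s. s \<noteq> z \<Longrightarrow> dist s z < e \<Longrightarrow> B < norm (g s) \<and> s \<in> U"
    unfolding eventually_at by auto
  \<comment> \<open>A shift to the right enters the open half-plane even from the imaginary axis;
    half of \<open>e\<close> stays in the ball and avoids \<open>z\<close>.\<close>
  define w where "w = z + of_real (e / 2)"
  have w: "w \<in> rhp" "w \<in> ball z e - {z}"
    using z e(1) by (auto simp: w_def rhp_def dist_norm)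
  have "\<forall>\<^sub>F s in at w. s \<in> ball z e - {z}"
    using w(2) by (intro eventually_at_in_open') auto
  \<comment> \<open>\<open>b\<close> may vanish at \<open>w\<close> itself, so the contradiction is
    drawn at points near \<open>w\<close>, where zeros of \<open>b\<close> are isolated.\<close>
  with hinf_eventually_nonzero[OF b(1) w(1)]
  have "\<forall>\<^sub>F s in at w. False"
  proof eventually_elim
    case (elim s)
    then have "B < norm (g s)" "s \<in> U"
      using e(2)[of s] by (auto simp: dist_commute)
    with elim gc[of s] B[of s] show False by auto
  qed
  then show False by simp
qed

lemma stable_imp_no_pole:
  assumes "stable A" "Re z \<ge> 0"
  shows "\<not> has_pole_at A z"
proof
  assume "has_pole_at A z"
  then obtain U g i j where *: "open U" "z \<in> U" "i < dim_row A" "j < dim_col A"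
    "tf_extends (A $$ (i, j)) U (g i j)" "is_pole (g i j) z"
    unfolding has_pole_at_def by blast
  moreover obtain c where "A $$ (i, j) = to_fract c"
    using assms(1) *(3,4) unfolding stable_iff by blast
  ultimately show False
    using no_pole_if_tf_extends_to_fract[of c U "g i j" z] assms(2) by simp
qed

theorem corollary3p2:
  fixes G :: "(nat, nat) pre_digraph"
    and \<nu> \<mu> p m :: nat
    and P :: "nat \<Rightarrow> tf mat"
    and P0 :: "tf mat"
  assumes "\<nu> \<ge> 1"
    and "loopfree_digraph G" and "verts G = {..<\<nu>}" and "arcs G = {..<\<mu>}"
    and "P0 \<in> carrier_mat p m"
    and "\<forall>i<\<nu>. P i = P0"
    and "has_coprime_factorizations P0"
    and "\<exists>z. Re z \<ge> 0 \<and> has_pole_at P0 z"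
  shows "\<not> (\<exists>Ke :: nat \<Rightarrow> tf mat. (\<forall>j<\<mu>. Ke j \<in> carrier_mat m p) \<and>
    internally_stable (block_diag \<nu> P) (diffusive_controller \<nu> \<mu> G p m Ke))"
proof
  assume "\<exists>Ke :: nat \<Rightarrow> tf mat. (\<forall>j<\<mu>. Ke j \<in> carrier_mat m p) \<and>
    internally_stable (block_diag \<nu> P) (diffusive_controller \<nu> \<mu> G p m Ke)"
  \<comment> \<open>Only the indices below \<open>\<nu>\<close> enter \<open>block_diag\<close>, so
    agreement there suffices.\<close>
  moreover have "block_diag \<nu> P = block_diag \<nu> (\<lambda>_. P0)"
    using assms(6) unfolding block_diag_def by (intro arg_cong[of _ _ diag_block_mat]) simp
  ultimately have "stable P0"
    using stable_agent_of_internally_stable[OF assms(1-5)] by auto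
  then show False
    using stable_imp_no_pole assms(8) by blast
qed

end
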